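(* For any $n>4$ there are full harmonic morphisms from $\mathbb{R}^n$ to $\mathbb{C}$ which do not arise from Kähler structures.
   Context: A harmonic morphism $\phi:\mathbb{R}^n\to\mathbb{C}$ is a smooth map with $\sum_i \partial^2\phi/(\partial x^i)^2=0$ and $\sum_i(\partial\phi/\partial x^i)^2=0$. A map $\phi:\mathbb{R}^n\to\mathbb{C}$ is full if it cannot be written as $\phi=\psi\circ\pi_A$ for some orthogonal projection $\pi_A$ of $\mathbb{R}^n$ onto a proper linear subspace $A$ and some map $\psi:A\to\mathbb{C}$. If $\phi=\psi\circ\pi_A$, then $\psi$ is called a reduction of $\phi$. A Kähler structure on $\mathbb{R}^{2m}$ is a constant (parallel) orthogonal complex structure $J$ ($J$ orthogonal, $J^2=-I$); a map $\phi$ into $\mathbb{C}$ is holomorphic with respect to $J$ if $d\phi(JX)=\mathrm{i}\,d\phi(X)$ for all tangent vectors $X$. A map $\phi:U\to\mathbb{C}$ on an open set $U\subset\mathbb{R}^n$ arises from a Kähler structure if either $n$ is even and $\phi$ is holomorphic with respect to a Kähler structure on $\mathbb{R}^n$, or $n$ is odd and $\phi$ is the reduction (to $\mathbb{R}^n\subset\mathbb{R}^{n+1}$) of a map on an open subset of $\mathbb{R}^{n+1}$ which is holomorphic with respect to a Kähler structure on $\mathbb{R}^{n+1}$. *)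

theory Defs
  imports "HOL-Analysis.Analysis"
begin

text \<open>\<open>Ck_on k U f\<close>: all iterated directional derivatives of order less than \<open>k\<close> are (Frechet)
  differentiable on the open set \<open>U\<close>, and those of order \<open>k\<close> are continuous.\<close>

fun Ck_on :: "nat \<Rightarrow> 'a::real_normed_vector set \<Rightarrow> ('a \<Rightarrow> 'b::real_normed_vector) \<Rightarrow> bool" where
  "Ck_on 0 U f \<longleftrightarrow> continuous_on U f"
| "Ck_on (Suc k) U f \<longleftrightarrow>
     (\<forall>x\<in>U. f differentiable (at x)) \<and> (\<forall>v. Ck_on k U (\<lambda>x. frechet_derivative f (at x) v))"

definition smooth_map_on :: "'a::real_normed_vector set \<Rightarrow> ('a \<Rightarrow> 'b::real_normed_vector) \<Rightarrow> bool" where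
  "smooth_map_on U f \<longleftrightarrow> (\<forall>k. Ck_on k U f)"

definition partial_deriv :: "'n::finite \<Rightarrow> (real^'n \<Rightarrow> complex) \<Rightarrow> real^'n \<Rightarrow> complex" where
  "partial_deriv i \<phi> x = vector_derivative (\<lambda>t. \<phi> (x + t *\<^sub>R axis i 1)) (at 0)"

definition harmonic_morphism :: "(real^'n::finite \<Rightarrow> complex) \<Rightarrow> bool" where
  "harmonic_morphism \<phi> \<longleftrightarrow>
     smooth_map_on UNIV \<phi> \<and>
     (\<forall>x. (\<Sum>i\<in>UNIV. partial_deriv i (partial_deriv i \<phi>) x) = 0) \<and>
     (\<forall>x. (\<Sum>i\<in>UNIV. (partial_deriv i \<phi> x)\<^sup>2) = 0)"

definition orth_proj :: "'a::euclidean_space set \<Rightarrow> 'a \<Rightarrow> 'a" where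
  "orth_proj A x = (THE y. y \<in> A \<and> (\<forall>a\<in>A. orthogonal (x - y) a))"

lemma orth_proj_eqI:
  assumes "subspace A" "y \<in> A" "\<And>a. a \<in> A \<Longrightarrow> orthogonal (x - y) a"
  shows "orth_proj A x = y"
  unfolding orth_proj_def
proof (rule the_equality)
  show "y \<in> A \<and> (\<forall>a\<in>A. orthogonal (x - y) a)" using assms by blast
  fix z assume z: "z \<in> A \<and> (\<forall>a\<in>A. orthogonal (x - z) a)"
  have d: "z - y \<in> A" using z assms subspace_diff by blast
  have "(x - y) \<bullet> (z - y) = 0" "(x - z) \<bullet> (z - y) = 0"
    using z d assms(3) by (auto simp: orthogonal_def)
  hence "(z - y) \<bullet> (z - y) = 0"
    by (simp add: inner_diff_left)
  thus "z = y" by simp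
qed

lemma orth_proj:
  assumes "subspace A"
  shows "orth_proj A x \<in> A" and "a \<in> A \<Longrightarrow> orthogonal (x - orth_proj A x) a"
proof -
  obtain y z where yz: "y \<in> span A" "\<And>w. w \<in> span A \<Longrightarrow> orthogonal z w" "x = y + z"
    using orthogonal_subspace_decomp_exists[of A x] by metis
  have sp: "span A = A" using assms by (simp add: span_eq_iff)
  have "orth_proj A x = y"
    by (rule orth_proj_eqI) (use assms yz sp in auto)
  thus "orth_proj A x \<in> A" "a \<in> A \<Longrightarrow> orthogonal (x - orth_proj A x) a"
    using yz sp by auto
qed

text \<open>\<open>reduction_of A V \<phi> W \<psi>\<close>: the map \<open>\<phi>\<close> on \<open>V\<close> is the composition of the orthogonal projection
  onto \<open>A\<close> with \<open>\<psi>\<close>, where \<open>\<psi>\<close> has domain \<open>W \<subseteq> A\<close> (its values elsewhere are immaterial).\<close>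

definition reduction_of ::
  "'a::euclidean_space set \<Rightarrow> 'a set \<Rightarrow> ('a \<Rightarrow> complex) \<Rightarrow> 'a set \<Rightarrow> ('a \<Rightarrow> complex) \<Rightarrow> bool" where
  "reduction_of A V \<phi> W \<psi> \<longleftrightarrow>
     subspace A \<and> W = orth_proj A ` V \<and> (\<forall>x\<in>V. \<phi> x = \<psi> (orth_proj A x))"

definition full :: "('a::euclidean_space \<Rightarrow> complex) \<Rightarrow> bool" where
  "full \<phi> \<longleftrightarrow> \<not> (\<exists>A \<psi>. subspace A \<and> A \<noteq> UNIV \<and> reduction_of A UNIV \<phi> A \<psi>)"

definition Kaehler_structure :: "('a::euclidean_space \<Rightarrow> 'a) \<Rightarrow> bool" where
  "Kaehler_structure J \<longleftrightarrow> orthogonal_transformation J \<and> (\<forall>X. J (J X) = - X)"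

definition holomorphic_wrt ::
  "('a::euclidean_space \<Rightarrow> 'a) \<Rightarrow> 'a set \<Rightarrow> ('a \<Rightarrow> complex) \<Rightarrow> bool" where
  "holomorphic_wrt J U \<phi> \<longleftrightarrow>
     (\<forall>x\<in>U. \<phi> differentiable (at x) \<and>
        (\<forall>X. frechet_derivative \<phi> (at x) (J X) = \<i> * frechet_derivative \<phi> (at x) X))"

text \<open>For odd \<open>n\<close>, the space \<open>\<real>\<^sup>n\<^sup>+\<^sup>1\<close> is \<open>(real^'n) \<times> real\<close> with its product inner product, and
  \<open>\<real>\<^sup>n\<close> sits inside it as \<open>\<real>\<^sup>n \<times> {0}\<close>; under this identification \<open>\<phi>\<close> becomes
  \<open>\<phi> \<circ> fst\<close> on \<open>U \<times> {0}\<close>. The set \<open>U\<close> is meant to be open.\<close>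

definition arises_from_Kaehler :: "(real^'n::finite) set \<Rightarrow> (real^'n \<Rightarrow> complex) \<Rightarrow> bool" where
  "arises_from_Kaehler U \<phi> \<longleftrightarrow>
     (even CARD('n) \<and> (\<exists>J. Kaehler_structure J \<and> holomorphic_wrt J U \<phi>)) \<or>
     (odd CARD('n) \<and>
       (\<exists>(J :: (real^'n) \<times> real \<Rightarrow> (real^'n) \<times> real) V \<Phi>.
          Kaehler_structure J \<and> open V \<and> holomorphic_wrt J V \<Phi> \<and>
          reduction_of (UNIV \<times> {0}) V \<Phi> (U \<times> {0}) (\<phi> \<circ> fst)))"

lemma orth_proj_Times_zero: "orth_proj (UNIV \<times> {0}) (x, t) = (x, 0)"
  by (rule orth_proj_eqI) (auto simp: orthogonal_def subspace_Times)

end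

theory Submission
  imports Defs "HOL-Computational_Algebra.Polynomial"
begin

text \<open>
  Write \<open>\<zeta> x = x\<^sub>p + \<i> x\<^sub>q\<close> and let \<open>\<phi> x = \<Sum>\<^sub>j a\<^sub>j(\<zeta> x) x\<^sub>j\<close> for complex polynomials \<open>a\<^sub>j\<close> with
  \<open>a\<^sub>p = a\<^sub>q = 0\<close> and \<open>\<Sum>\<^sub>j a\<^sub>j\<^sup>2 = 0\<close>. The gradient of \<open>\<phi>\<close> is \<open>a(\<zeta> x)\<close> plus a multiple of the null vector
  \<open>e\<^sub>p + \<i> e\<^sub>q\<close>, and \<open>a\<close> is null and orthogonal to that vector, so \<open>\<phi>\<close> is a harmonic morphism.
  A map holomorphic with respect to a Kaehler structure has all its gradients, at different
  points too, in one isotropic subspace, whereas here \<open>\<nabla>\<phi>(x) \<cdot> \<nabla>\<phi>(y) = a(\<zeta> x) \<cdot> a(\<zeta> y)\<close> for \<open>x = 0\<close>,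
  \<open>y = e\<^sub>p\<close>. As soon as there are three coordinates besides \<open>p, q\<close>, the null curve
  \<open>a = (P - 1, \<i>(P + 1), z, z\<^sup>2, \<dots>)\<close> with \<open>4 P = z\<^sup>2 + z\<^sup>4 + \<dots>\<close> makes this product nonzero;
  its components are linearly independent over the reals, which yields fullness.
\<close>

section \<open>Partial derivatives from the Frechet derivative\<close>

lemma partial_deriv_eq:
  assumes "(f has_derivative f') (at x)"
  shows "partial_deriv i f x = f' (axis i 1)"
proof -
  have "((\<lambda>t. x + t *\<^sub>R axis i 1) has_derivative (\<lambda>t. t *\<^sub>R axis i 1)) (at (0::real))"
    by (auto intro!: derivative_eq_intros)
  then have "((\<lambda>t. f (x + t *\<^sub>R axis i 1)) has_derivative (\<lambda>t. f' (t *\<^sub>R axis i 1))) (at 0)"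
    using has_derivative_compose assms by fastforce
  moreover have "f' (t *\<^sub>R axis i 1) = t *\<^sub>R f' (axis i 1)" for t
    using assms by (simp add: has_derivative_linear linear_scale)
  ultimately have "((\<lambda>t. f (x + t *\<^sub>R axis i 1)) has_vector_derivative f' (axis i 1)) (at 0)"
    by (simp add: has_vector_derivative_def)
  then show ?thesis
    unfolding partial_deriv_def by (rule vector_derivative_at)
qed

subsection \<open>Isotropy of the gradients of holomorphic maps\<close>

text \<open>The sum is the complex bilinear pairing of \<open>f\<close> and \<open>g\<close>, the
  same in every orthonormal basis. Passing from the basis vectors \<open>b\<close> to
  \<open>J b\<close> multiplies each term by i^2 = -1, so the pairing equals its own
  negative.\<close>

lemma Kaehler_sum_Basis_eq_0:
  fixes f g :: "'a::euclidean_space \<Rightarrow> complex"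
  assumes J: "Kaehler_structure J" and "linear f" "linear g"
    and fJ: "\<And>X. f (J X) = \<i> * f X" and gJ: "\<And>X. g (J X) = \<i> * g X"
  shows "(\<Sum>b\<in>Basis. f b * g b) = 0"
proof -
  have J2: "J (J X) = - X" and Jinner: "J X \<bullet> J Y = X \<bullet> Y" for X Y
    using J by (auto simp: Kaehler_structure_def orthogonal_transformation_def)
  have expand: "h (J b) = (\<Sum>c\<in>Basis. (J b \<bullet> c) *\<^sub>R h c)" if h: "linear h" for h :: "'a \<Rightarrow> complex" and b
  proof -
    have "h (J b) = h (\<Sum>c\<in>Basis. (J b \<bullet> c) *\<^sub>R c)"
      by (simp only: euclidean_representation)
    also have "\<dots> = (\<Sum>c\<in>Basis. (J b \<bullet> c) *\<^sub>R h c)"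
      by (simp only: linear_sum[OF h] linear_scale[OF h])
    finally show ?thesis .
  qed
  have skew: "J b \<bullet> c = - (J c \<bullet> b)" for b c
    using Jinner[of "J b" c] by (simp add: J2 inner_commute[of b])
  \<comment> \<open>Skewness moves \<open>J\<close> onto \<open>c\<close> and \<open>d\<close>,
    turning the sum into the coordinate expansion of \<open>J c \<bullet> J d\<close>.\<close>
  have orth: "(\<Sum>b\<in>Basis. (J b \<bullet> c) * (J b \<bullet> d)) = c \<bullet> d" for c d
  proof -
    have "(\<Sum>b\<in>Basis. (J b \<bullet> c) * (J b \<bullet> d)) = (\<Sum>b\<in>Basis. (J c \<bullet> b) * (J d \<bullet> b))"
      by (simp only: skew[of _ c] skew[of _ d] minus_mult_minus)
    then show ?thesis
      by (simp only: euclidean_inner[symmetric] Jinner)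
  qed
  have "(\<Sum>b\<in>Basis. f (J b) * g (J b))
      = (\<Sum>b\<in>Basis. \<Sum>c\<in>Basis. \<Sum>d\<in>Basis. ((J b \<bullet> c) * (J b \<bullet> d)) *\<^sub>R (f c * g d))"
    by (simp only: expand[OF assms(2)] expand[OF assms(3)] sum_product mult_scaleR_left mult_scaleR_right
        scaleR_scaleR) (simp only: mult.commute)
  also have "\<dots> = (\<Sum>c\<in>Basis. \<Sum>b\<in>Basis. \<Sum>d\<in>Basis. ((J b \<bullet> c) * (J b \<bullet> d)) *\<^sub>R (f c * g d))"
    by (rule sum.swap)
  also have "\<dots> = (\<Sum>c\<in>Basis. \<Sum>d\<in>Basis. \<Sum>b\<in>Basis. ((J b \<bullet> c) * (J b \<bullet> d)) *\<^sub>R (f c * g d))"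
    by (intro sum.cong refl sum.swap)
  also have "\<dots> = (\<Sum>c\<in>Basis. \<Sum>d\<in>Basis. (c \<bullet> d) *\<^sub>R (f c * g d))"
    by (simp only: scaleR_sum_left[symmetric] orth)
  also have "\<dots> = (\<Sum>c\<in>Basis. f c * g c)"
  proof (rule sum.cong[OF refl])
    fix c :: 'a assume c: "c \<in> Basis"
    have "(\<Sum>d\<in>Basis. (c \<bullet> d) *\<^sub>R (f c * g d)) = (\<Sum>d\<in>Basis. if d = c then f c * g d else 0)"
      using c by (intro sum.cong) (auto simp: inner_Basis)
    then show "(\<Sum>d\<in>Basis. (c \<bullet> d) *\<^sub>R (f c * g d)) = f c * g c"
      using c by simp
  qed
  finally have "(\<Sum>b\<in>Basis. f (J b) * g (J b)) = (\<Sum>b\<in>Basis. f b * g b)" .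
  moreover have "f (J b) * g (J b) = - (f b * g b)" for b
    by (simp add: fJ gJ complex_eq_iff algebra_simps)
  ultimately show ?thesis
    by (simp add: sum_negf)
qed

lemma sum_Basis_vec: "(\<Sum>b\<in>Basis. h (b::real^'n)) = (\<Sum>i\<in>UNIV. h (axis i 1))"
proof -
  have "(Basis :: (real^'n) set) = (\<lambda>i. axis i 1) ` UNIV"
    by (auto simp: Basis_vec_def)
  then have "sum h Basis = sum h ((\<lambda>i. axis i 1) ` UNIV)"
    by (rule arg_cong)
  also have "\<dots> = (\<Sum>i\<in>UNIV. h (axis i 1))"
    by (subst sum.reindex) (simp_all add: inj_on_def axis_eq_axis)
  finally show ?thesis .
qed

text \<open>One constant \<open>J\<close> serves all points, so the derivatives at \<open>x\<close>
  and \<open>y\<close> are complex linear for the same \<open>J\<close>. In odd dimension this holds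
  for their pullbacks along \<open>fst\<close>.\<close>

lemma arises_from_Kaehler_UNIV_isotropic:
  fixes \<phi> :: "real^'n \<Rightarrow> complex"
  assumes "arises_from_Kaehler UNIV \<phi>" and d: "\<And>x. (\<phi> has_derivative \<phi>' x) (at x)"
  shows "(\<Sum>i\<in>UNIV. \<phi>' x (axis i 1) * \<phi>' y (axis i 1)) = 0"
  using assms(1) unfolding arises_from_Kaehler_def
proof (elim disjE conjE exE)
  fix J assume J: "Kaehler_structure J" and hol: "holomorphic_wrt J UNIV \<phi>"
  have "frechet_derivative \<phi> (at x) = \<phi>' x" for x
    by (simp only: frechet_derivative_at[OF d, symmetric])
  then have "\<phi>' x (J X) = \<i> * \<phi>' x X" for x X
    using hol by (simp add: holomorphic_wrt_def)
  then have "(\<Sum>b\<in>Basis. \<phi>' x b * \<phi>' y b) = 0"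
    using d has_derivative_linear by (intro Kaehler_sum_Basis_eq_0[OF J]) blast+
  then show ?thesis
    by (simp add: sum_Basis_vec)
next
  fix J :: "(real^'n) \<times> real \<Rightarrow> (real^'n) \<times> real" and V \<Phi>
  assume J: "Kaehler_structure J" and V: "open V" and hol: "holomorphic_wrt J V \<Phi>"
    and red: "reduction_of (UNIV \<times> {0}) V \<Phi> (UNIV \<times> {0}) (\<phi> \<circ> fst)"
  have \<Phi>: "\<Phi> w = \<phi> (fst w)" if "w \<in> V" for w
    using red that by (cases w) (auto simp: reduction_of_def orth_proj_Times_zero)
  have lin: "linear (\<phi>' u \<circ> fst)" for u
    using has_derivative_linear[OF d] by (intro linear_compose linear_fst)
  have JX: "(\<phi>' u \<circ> fst) (J X) = \<i> * (\<phi>' u \<circ> fst) X" for u X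
  proof -
    \<comment> \<open>The reduction has domain all of \<open>UNIV \<times> {0}\<close>, so
      \<open>V\<close> contains a point above every \<open>u\<close>.\<close>
    have "(u, 0) \<in> orth_proj (UNIV \<times> {0}) ` V"
      using red by (auto simp: reduction_of_def)
    then obtain t where t: "(u, t) \<in> V"
      by (auto simp: orth_proj_Times_zero)
    have "((\<lambda>w. \<phi> (fst w)) has_derivative (\<lambda>w. \<phi>' u (fst w))) (at (u, t))"
      using has_derivative_compose[OF bounded_linear_imp_has_derivative[OF bounded_linear_fst], of \<phi> "\<phi>' u" "(u, t)"] d
      by simp
    then have "(\<Phi> has_derivative (\<lambda>w. \<phi>' u (fst w))) (at (u, t))"
      by (rule has_derivative_transform_within_open[OF _ V t]) (simp add: \<Phi>)
    then have "frechet_derivative \<Phi> (at (u, t)) = (\<lambda>w. \<phi>' u (fst w))"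
      by (metis frechet_derivative_at)
    then show ?thesis
      using hol t unfolding holomorphic_wrt_def by (metis comp_apply)
  qed
  have "(\<Sum>b\<in>(Basis :: ((real^'n) \<times> real) set). (\<phi>' x \<circ> fst) b * (\<phi>' y \<circ> fst) b) = 0"
    by (intro Kaehler_sum_Basis_eq_0[OF J] lin JX)
  \<comment> \<open>The extra basis vector \<open>(0, 1)\<close> contributes nothing, because
    \<open>fst\<close> sends it to zero.\<close>
  moreover have "sum h Basis = (\<Sum>i\<in>UNIV. h (axis i 1, 0)) + h (0, 1)" for h :: "(real^'n) \<times> real \<Rightarrow> complex"
    unfolding Basis_prod_def
    by (subst sum.union_disjoint) (auto simp: sum.reindex inj_on_def sum_Basis_vec)
  moreover have "\<phi>' x 0 = 0"
    using has_derivative_linear[OF d] by (rule linear_0)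
  ultimately show ?thesis
    by simp
qed

text \<open>A map factoring through the projection onto a proper subspace is invariant under
  translation by a nonzero vector orthogonal to that subspace.\<close>

lemma fullI:
  assumes "\<And>v. (\<And>x. \<phi> (x + v) = \<phi> x) \<Longrightarrow> v = 0"
  shows "full \<phi>"
  unfolding full_def
proof clarify
  fix A \<psi>
  assume A: "subspace A" "A \<noteq> UNIV" and red: "reduction_of A UNIV \<phi> A \<psi>"
  have "span A \<subset> UNIV"
    using A by (metis span_eq_iff psubsetI subset_UNIV)
  then obtain v where v: "v \<noteq> 0" "\<And>y. y \<in> span A \<Longrightarrow> orthogonal v y"
    using orthogonal_to_subspace_exists_gen[of A UNIV] by auto
  have "orth_proj A (x + v) = orth_proj A x" for x
  proof (rule orth_proj_eqI[OF A(1) orth_proj(1)[OF A(1)]])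
    fix a assume "a \<in> A"
    then have "orthogonal (x - orth_proj A x) a" "orthogonal v a"
      using orth_proj(2)[OF A(1)] v(2) span_base by blast+
    then show "orthogonal (x + v - orth_proj A x) a"
      by (simp add: orthogonal_def inner_diff_left inner_add_left)
  qed
  then have "\<phi> (x + v) = \<phi> x" for x
    using red by (simp add: reduction_of_def)
  with assms v(1) show False by blast
qed

subsection \<open>Maps that are affine over one complex coordinate\<close>

definition cplx_coord :: "'n \<Rightarrow> 'n \<Rightarrow> real^'n::finite \<Rightarrow> complex" where
  "cplx_coord p q x = of_real (x $ p) + \<i> * of_real (x $ q)"

text \<open>The inhomogeneous term \<open>b\<close> makes this class of maps closed under directional derivatives.\<close>

definition affine_over ::
  "'n \<Rightarrow> 'n \<Rightarrow> ('n \<Rightarrow> complex poly) \<Rightarrow> complex poly \<Rightarrow> real^'n::finite \<Rightarrow> complex" where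
  "affine_over p q a b x =
     (\<Sum>j\<in>UNIV. poly (a j) (cplx_coord p q x) * of_real (x $ j)) + poly b (cplx_coord p q x)"

lemma linear_cplx_coord: "linear (cplx_coord p q)"
  by (rule linearI) (simp_all add: cplx_coord_def complex_eq_iff)

lemma has_derivative_cplx_coord: "(cplx_coord p q has_derivative cplx_coord p q) (at x)"
  using linear_cplx_coord by (intro bounded_linear_imp_has_derivative) (simp add: linear_conv_bounded_linear)

lemma has_derivative_poly_cplx_coord:
  "((\<lambda>x. poly c (cplx_coord p q x)) has_derivative
     (\<lambda>v. poly (pderiv c) (cplx_coord p q x) * cplx_coord p q v)) (at x)"
  using poly_DERIV[of c "cplx_coord p q x"] unfolding has_field_derivative_def
  by (rule has_derivative_compose[OF has_derivative_cplx_coord])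

text \<open>By the product rule, differentiating the coefficients keeps the terms linear in
  \<open>x $ j\<close>, while differentiating \<open>x $ j\<close> feeds \<open>a j\<close> into the
  inhomogeneous term.\<close>

lemma has_derivative_affine_over:
  "(affine_over p q a b has_derivative
     (\<lambda>v. affine_over p q (\<lambda>j. smult (cplx_coord p q v) (pderiv (a j)))
       ((\<Sum>j\<in>UNIV. smult (of_real (v $ j)) (a j)) + smult (cplx_coord p q v) (pderiv b)) x)) (at x)"
proof -
  have nth: "((\<lambda>x. complex_of_real (x $ j)) has_derivative (\<lambda>v. of_real (v $ j))) (at x)" for j
    by (intro bounded_linear_imp_has_derivative bounded_linear_compose[OF bounded_linear_of_real]
        bounded_linear_vec_nth)
  show ?thesis
    unfolding affine_over_def[abs_def]
    by (rule has_derivative_eq_rhs,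
        rule has_derivative_add[OF has_derivative_sum[OF has_derivative_mult[OF has_derivative_poly_cplx_coord nth]]
          has_derivative_poly_cplx_coord])
      (simp add: fun_eq_iff poly_sum sum.distrib algebra_simps)
qed

lemma Ck_on_affine_over: "Ck_on k UNIV (affine_over p q a b)"
proof (induction k arbitrary: a b)
  case 0
  show ?case
    unfolding Ck_on.simps
    by (intro continuous_at_imp_continuous_on ballI has_derivative_continuous[OF has_derivative_affine_over])
next
  case (Suc k)
  have "frechet_derivative (affine_over p q a b) (at x) v
      = affine_over p q (\<lambda>j. smult (cplx_coord p q v) (pderiv (a j)))
          ((\<Sum>j\<in>UNIV. smult (of_real (v $ j)) (a j)) + smult (cplx_coord p q v) (pderiv b)) x" for x v
    by (simp add: frechet_derivative_at[OF has_derivative_affine_over, symmetric])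
  then show ?case
    using Suc has_derivative_affine_over unfolding Ck_on.simps differentiable_def by simp blast
qed

section \<open>The harmonic morphism equations, isotropy failure and fullness\<close>

lemma cplx_coord_axis:
  "p \<noteq> q \<Longrightarrow> cplx_coord p q (axis i 1) = (if i = p then 1 else if i = q then \<i> else 0)"
  by (auto simp: cplx_coord_def axis_def)

lemma partial_deriv_affine_over:
  "partial_deriv i (affine_over p q a b) =
     affine_over p q (\<lambda>j. smult (cplx_coord p q (axis i 1)) (pderiv (a j)))
       (a i + smult (cplx_coord p q (axis i 1)) (pderiv b))"
proof -
  have "(\<Sum>j\<in>UNIV. smult (of_real (axis i 1 $ j)) (a j)) = (\<Sum>j\<in>UNIV. if j = i then a j else 0)"
    by (intro sum.cong) (auto simp: axis_def)
  then show ?thesis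
    by (auto simp: partial_deriv_eq[OF has_derivative_affine_over])
qed

lemma sum_two_indices:
  fixes p q :: "'n::finite"
  assumes "p \<noteq> q" "\<And>i. i \<noteq> p \<Longrightarrow> i \<noteq> q \<Longrightarrow> h i = 0"
  shows "sum h UNIV = h p + h q"
proof -
  have "sum h UNIV = sum h {p, q}"
    by (rule sum.mono_neutral_right) (use assms in auto)
  then show ?thesis using assms(1) by simp
qed

lemma harmonic_morphism_affine_over:
  fixes a :: "'n::finite \<Rightarrow> complex poly"
  assumes pq: "p \<noteq> q" and a0: "a p = 0" "a q = 0" and null: "(\<Sum>j\<in>UNIV. (a j)\<^sup>2) = 0"
  shows "harmonic_morphism (affine_over p q a 0)"
proof -
  let ?\<omega> = "\<lambda>i. cplx_coord p q (axis i 1)"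
  have \<omega>: "?\<omega> p = 1" "?\<omega> q = \<i>" "\<And>i. i \<noteq> p \<Longrightarrow> i \<noteq> q \<Longrightarrow> ?\<omega> i = 0"
    using pq by (auto simp: cplx_coord_axis)
  have laplace: "(\<Sum>i\<in>UNIV. partial_deriv i (partial_deriv i (affine_over p q a 0)) x) = 0" for x
  proof -
    \<comment> \<open>Along every other axis the map is affine. The two remaining second derivatives
      carry the factors 1 and i^2 and cancel.\<close>
    have "(\<Sum>i\<in>UNIV. partial_deriv i (partial_deriv i (affine_over p q a 0)) x)
        = partial_deriv p (partial_deriv p (affine_over p q a 0)) x
          + partial_deriv q (partial_deriv q (affine_over p q a 0)) x"
      by (rule sum_two_indices[OF pq]) (simp add: partial_deriv_affine_over \<omega> affine_over_def)
    also have "\<dots> = 0"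
      by (simp add: partial_deriv_affine_over \<omega> affine_over_def a0 pderiv_smult sum_negf)
    finally show ?thesis .
  qed
  have conformal: "(\<Sum>i\<in>UNIV. (partial_deriv i (affine_over p q a 0) x)\<^sup>2) = 0" for x
  proof -
    \<comment> \<open>\<open>D\<close> is the derivative in the complex coordinate with the factors
      \<open>x $ j\<close> frozen.\<close>
    define D where "D = affine_over p q (\<lambda>j. pderiv (a j)) 0 x"
    have pd: "partial_deriv i (affine_over p q a 0) x = ?\<omega> i * D + poly (a i) (cplx_coord p q x)" for i
      by (simp add: partial_deriv_affine_over affine_over_def D_def sum_distrib_left mult.assoc)
    \<comment> \<open>Disjoint supports remove the cross term of the square.\<close>
    have "?\<omega> i * poly (a i) z = 0" for i z
      using \<omega>(3)[of i] a0 by (cases "i = p"; cases "i = q") auto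
    then have "?\<omega> i * D * poly (a i) z = 0" for i z
      by (metis mult.commute mult.left_commute mult_zero_left)
    then have "(partial_deriv i (affine_over p q a 0) x)\<^sup>2
        = (?\<omega> i)\<^sup>2 * D\<^sup>2 + poly ((a i)\<^sup>2) (cplx_coord p q x)" for i
      by (simp only: pd power2_sum power_mult_distrib poly_power mult.assoc) simp
    moreover have "(\<Sum>i\<in>UNIV. (?\<omega> i)\<^sup>2) = 0"
      using sum_two_indices[OF pq, of "\<lambda>i. (?\<omega> i)\<^sup>2"] \<omega> by simp
    ultimately show ?thesis
      using arg_cong[OF null, of "\<lambda>f. poly f (cplx_coord p q x)"]
      by (simp add: sum.distrib sum_distrib_right[symmetric] poly_sum)
  qed
  show ?thesis
    unfolding harmonic_morphism_def smooth_map_on_def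
    using Ck_on_affine_over laplace conformal by blast
qed

text \<open>At 0 and at \<open>axis p 1\<close> every factor \<open>x $ j\<close> with a nonzero
  coefficient vanishes, so the gradients there are exactly the values of \<open>a\<close> at 0 and
  1.\<close>

lemma affine_over_not_Kaehler:
  fixes a :: "'n::finite \<Rightarrow> complex poly"
  assumes pq: "p \<noteq> q" and a0: "a p = 0" "a q = 0"
    and nz: "(\<Sum>j\<in>UNIV. poly (a j) 0 * poly (a j) 1) \<noteq> 0"
  shows "\<not> arises_from_Kaehler UNIV (affine_over p q a 0)"
proof
  assume "arises_from_Kaehler UNIV (affine_over p q a 0)"
  from arises_from_Kaehler_UNIV_isotropic[OF this has_derivative_affine_over, of 0 "axis p 1"]
  have "(\<Sum>i\<in>UNIV. partial_deriv i (affine_over p q a 0) 0 * partial_deriv i (affine_over p q a 0) (axis p 1)) = 0"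
    by (simp add: partial_deriv_eq[OF has_derivative_affine_over])
  moreover have "affine_over p q (\<lambda>j. smult c (pderiv (a j))) b (axis p 1) = poly b 1" for b c
  proof -
    have "(\<Sum>j\<in>UNIV. poly (smult c (pderiv (a j))) 1 * of_real (axis p 1 $ j)) = (0::complex)"
      by (rule sum.neutral) (use a0 in \<open>auto simp: axis_def\<close>)
    then show ?thesis
      using pq by (simp add: affine_over_def cplx_coord_axis del: poly_smult)
  qed
  moreover have "affine_over p q c b 0 = poly b 0" for b c
    by (simp add: affine_over_def cplx_coord_def)
  ultimately show False
    using nz by (simp add: partial_deriv_affine_over)
qed

text \<open>A step along axis \<open>k\<close> changes the map by \<open>poly (a k)\<close> at the
  complex coordinate. Comparing this step at \<open>v\<close> and at 0 forces \<open>v\<close> to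
  have complex coordinate 0; invariance under \<open>v\<close> is then a real linear relation among
  the \<open>a j\<close>.\<close>

lemma full_affine_over:
  fixes a :: "'n::finite \<Rightarrow> complex poly"
  assumes pq: "p \<noteq> q" and a0: "a p = 0" "a q = 0"
    and k: "\<And>c. poly (a k) c = poly (a k) 0 \<Longrightarrow> c = 0"
    and indep: "\<And>v :: real^'n. (\<Sum>j\<in>UNIV. smult (of_real (v $ j)) (a j)) = 0 \<Longrightarrow>
                  v $ p = 0 \<Longrightarrow> v $ q = 0 \<Longrightarrow> v = 0"
  shows "full (affine_over p q a 0)"
proof (rule fullI)
  fix v :: "real^'n"
  assume inv: "\<And>x. affine_over p q a 0 (x + v) = affine_over p q a 0 x"
  define c where "c = cplx_coord p q v"
  have shift: "cplx_coord p q (x + y) = cplx_coord p q x + cplx_coord p q y" for x y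
    by (simp add: linear_cplx_coord linear_add)
  \<comment> \<open>For \<open>k\<close> equal to \<open>p\<close> or \<open>q\<close> the
    polynomial is zero, and the hypothesis would give 1 = 0.\<close>
  have kpq: "k \<noteq> p" "k \<noteq> q"
    using k[of 1] a0 by auto
  have \<zeta>k: "cplx_coord p q (axis k 1) = 0"
    using kpq pq by (simp add: cplx_coord_axis)
  have coef: "affine_over p q a 0 (x + axis k 1) = affine_over p q a 0 x + poly (a k) (cplx_coord p q x)" for x
  proof -
    have "(\<Sum>j\<in>UNIV. poly (a j) (cplx_coord p q x) * of_real (axis k 1 $ j))
        = (\<Sum>j\<in>UNIV. if j = k then poly (a j) (cplx_coord p q x) else 0)"
      by (intro sum.cong) (auto simp: axis_def)
    then show ?thesis
      by (simp add: affine_over_def shift \<zeta>k distrib_left sum.distrib)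
  qed
  have "poly (a k) c = poly (a k) 0"
    using coef[of v] coef[of 0] inv[of "axis k 1"] inv[of 0]
    by (simp add: add.commute c_def) (simp add: cplx_coord_def)
  then have c0: "c = 0" by (rule k)
  then have v0: "v $ p = 0" "v $ q = 0"
    by (auto simp: c_def cplx_coord_def complex_eq_iff)
  have "poly (\<Sum>j\<in>UNIV. smult (of_real (v $ j)) (a j)) z = 0" for z
  proof -
    define x :: "real^'n" where "x = Re z *\<^sub>R axis p 1 + Im z *\<^sub>R axis q 1"
    have "cplx_coord p q x = z"
      using pq by (auto simp: x_def cplx_coord_def axis_def complex_eq_iff)
    then show ?thesis
      using inv[of x] c0
      by (simp add: affine_over_def shift c_def[symmetric] distrib_left sum.distrib poly_sum mult.commute)
  qed
  then have "(\<Sum>j\<in>UNIV. smult (of_real (v $ j)) (a j)) = 0"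
    using poly_all_0_iff_0 by blast
  then show "v = 0"
    using v0 by (rule indep)
qed

subsection \<open>The null curve\<close>

text \<open>Two slots \<open>r\<close>, \<open>s\<close> absorb the squares of all the others, since
  (P - 1)^2 - (P + 1)^2 = -4P. Distinct positive powers in the other slots give
  independence.\<close>

lemma exists_null_curve:
  assumes card: "CARD('n::finite) > 4"
  obtains p q k :: "'n::finite" and a :: "'n::finite \<Rightarrow> complex poly" where
    "p \<noteq> q" "a p = 0" "a q = 0" "(\<Sum>j\<in>UNIV. (a j)\<^sup>2) = 0"
    "(\<Sum>j\<in>UNIV. poly (a j) 0 * poly (a j) 1) \<noteq> 0"
    "\<And>c. poly (a k) c = poly (a k) 0 \<Longrightarrow> c = 0"
    "\<And>v :: real^'n. (\<Sum>j\<in>UNIV. smult (of_real (v $ j)) (a j)) = 0 \<Longrightarrow>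
       v $ p = 0 \<Longrightarrow> v $ q = 0 \<Longrightarrow> v = 0"
proof -
  obtain T :: "'n set" where T: "card T = 4"
    using obtain_subset_with_card_n[of 4 "UNIV :: 'n set"] card by auto
  then obtain p q r s where Teq: "T = {p, q, r, s}"
      and dist: "p \<noteq> q" "p \<noteq> r" "p \<noteq> s" "q \<noteq> r" "q \<noteq> s" "r \<noteq> s"
    by (auto simp: numeral_eq_Suc dest!: card_eq_SucD)
  define K where "K = - {p, q, r, s}"
  \<comment> \<open>The bound on the dimension enters here: a fifth index makes \<open>P\<close>
    nonzero.\<close>
  have "K \<noteq> {}"
  proof
    assume "K = {}"
    then have "T = UNIV" by (auto simp: K_def Teq)
    with T card show False by simp
  qed
  then obtain k where k: "k \<in> K" by blast
  obtain e :: "'n \<Rightarrow> nat" where e: "inj e"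
    using finite_imp_inj_to_nat_seg[OF finite[of "UNIV :: 'n set"]] by blast
  \<comment> \<open>The successor keeps exponents positive, so the monomials and \<open>P\<close>
    vanish at 0.\<close>
  define g where "g j = Suc (e j)" for j
  define P :: "complex poly" where "P = (\<Sum>j\<in>K. monom (1/4) (2 * g j))"
  define a where "a j = (if j = p \<or> j = q then 0 else if j = r then P - 1
      else if j = s then smult \<i> (P + 1) else monom 1 (g j))" for j
  have a: "a p = 0" "a q = 0" "a r = P - 1" "a s = smult \<i> (P + 1)" "\<And>j. j \<in> K \<Longrightarrow> a j = monom 1 (g j)"
    using dist by (auto simp: a_def K_def)
  have split: "(\<Sum>j\<in>UNIV. h j) = h p + h q + h r + h s + (\<Sum>j\<in>K. h j)" for h :: "'n \<Rightarrow> 'b::comm_monoid_add"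
  proof -
    have "(\<Sum>j\<in>UNIV. h j) = (\<Sum>j\<in>{p, q, r, s}. h j) + (\<Sum>j\<in>K. h j)"
      unfolding K_def by (subst sum.union_disjoint[symmetric]) (auto simp: Un_commute)
    then show ?thesis using dist by (simp add: ac_simps)
  qed
  have P0: "poly P 0 = 0"
    by (simp add: P_def poly_sum poly_monom g_def)
  have "(\<Sum>j\<in>K. (a j)\<^sup>2) = (\<Sum>j\<in>K. smult 4 (monom (1/4) (2 * g j)))"
    by (intro sum.cong) (simp_all add: a power2_eq_square mult_monom smult_monom mult_2)
  also have "\<dots> = smult 4 P"
    by (simp add: P_def poly_eq_iff coeff_sum sum_distrib_left)
  finally have "(\<Sum>j\<in>UNIV. (a j)\<^sup>2) = (P - 1)\<^sup>2 - (P + 1)\<^sup>2 + smult 4 P"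
    by (simp add: split[of "\<lambda>j. (a j)\<^sup>2"] a smult_power)
  also have "\<dots> = 0"
    by (rule poly_eq_poly_eq_iff[THEN iffD1]) (simp add: fun_eq_iff power2_eq_square algebra_simps)
  finally have null: "(\<Sum>j\<in>UNIV. (a j)\<^sup>2) = 0" .
  \<comment> \<open>Only slots \<open>r\<close>, \<open>s\<close> contribute at 0, with values -1
    and i; the product is -(P(1) - 1) - (P(1) + 1).\<close>
  have "(\<Sum>j\<in>K. poly (a j) 0 * poly (a j) 1) = 0"
    by (intro sum.neutral) (auto simp: a poly_monom g_def)
  then have "(\<Sum>j\<in>UNIV. poly (a j) 0 * poly (a j) 1) = - 2 * poly P 1"
    unfolding split[of "\<lambda>j. poly (a j) 0 * poly (a j) 1"] by (simp add: a P0 algebra_simps)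
  moreover have "poly P 1 = of_nat (card K) / 4"
    by (simp add: P_def poly_sum poly_monom)
  moreover have "card K \<noteq> 0"
    using k by auto
  ultimately have nz: "(\<Sum>j\<in>UNIV. poly (a j) 0 * poly (a j) 1) \<noteq> 0"
    by simp
  have inj_k: "c = 0" if "poly (a k) c = poly (a k) 0" for c
    using that k by (auto simp: a poly_monom g_def)
  have indep: "v = 0" if sum0: "(\<Sum>j\<in>UNIV. smult (of_real (v $ j)) (a j)) = 0"
    and "v $ p = 0" "v $ q = 0" for v :: "real^'n"
  proof -
    note sum0' = sum0[unfolded split[of "\<lambda>j. smult (of_real (v $ j)) (a j)"]]
    \<comment> \<open>Evaluation at 0 isolates \<open>r\<close> and \<open>s\<close>, which separate
      because \<open>v\<close> is real. The rest is read off from coefficients.\<close>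
    have "poly (\<Sum>j\<in>K. smult (of_real (v $ j)) (a j)) 0 = 0"
      by (auto simp: poly_sum a poly_monom g_def intro!: sum.neutral)
    then have "- of_real (v $ r) + \<i> * of_real (v $ s) = (0::complex)"
      using arg_cong[OF sum0', of "\<lambda>f. poly f 0"] by (simp add: a P0 complex_eq_iff)
    then have rs: "v $ r = 0" "v $ s = 0"
      by (auto simp: complex_eq_iff)
    have K0: "(\<Sum>j\<in>K. smult (of_real (v $ j)) (a j)) = 0"
      using sum0' by (simp add: a rs)
    have K: "v $ i = 0" if "i \<in> K" for i
    proof -
      have "0 = (\<Sum>j\<in>K. coeff (smult (of_real (v $ j)) (a j)) (g i))"
        using arg_cong[OF K0, of "\<lambda>f. coeff f (g i)"] by (simp add: coeff_sum)
      also have "\<dots> = (\<Sum>j\<in>K. if j = i then of_real (v $ j) else 0)"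
        by (intro sum.cong) (use e in \<open>auto simp: a g_def inj_eq\<close>)
      finally show ?thesis
        using that by simp
    qed
    have "v $ i = 0" for i
      using that(2,3) rs K[of i] by (auto simp: K_def)
    then show ?thesis
      by (simp add: vec_eq_iff)
  qed
  show thesis
    by (rule that[OF dist(1) a(1,2) null nz inj_k indep])
qed

theorem corollary4p21:
  assumes "CARD('n::finite) > 4"
  shows "\<exists>\<phi> :: real^'n \<Rightarrow> complex.
           harmonic_morphism \<phi> \<and> full \<phi> \<and> \<not> arises_from_Kaehler UNIV \<phi>"
proof -
  obtain p q k :: 'n and a :: "'n \<Rightarrow> complex poly" where
      a: "p \<noteq> q" "a p = 0" "a q = 0" and null: "(\<Sum>j\<in>UNIV. (a j)\<^sup>2) = 0"
      and nz: "(\<Sum>j\<in>UNIV. poly (a j) 0 * poly (a j) 1) \<noteq> 0"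
      and k: "\<And>c. poly (a k) c = poly (a k) 0 \<Longrightarrow> c = 0"
      and indep: "\<And>v :: real^'n. (\<Sum>j\<in>UNIV. smult (of_real (v $ j)) (a j)) = 0 \<Longrightarrow>
         v $ p = 0 \<Longrightarrow> v $ q = 0 \<Longrightarrow> v = 0"
    by (rule exists_null_curve[OF assms]) (rule that; assumption)
  show ?thesis
    using harmonic_morphism_affine_over[OF a null] full_affine_over[OF a k indep]
      affine_over_not_Kaehler[OF a nz] by blast
qed

end
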